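(* For all real $a,b,c\ge 0$ with $abc=1$, the limit form $a\,\mathfrak{m}_{6}+b\,\mathfrak{m}_{4,2}+c\,\mathfrak{m}_{1^6}-3\,\mathfrak{m}_{4,1^2}$ belongs to $\mathfrak{P}_6$. Moreover, the limit form $$\tfrac12\,\mathfrak{m}_6+\tfrac12\,\mathfrak{m}_{4,2}+4\,\mathfrak{m}_{1^6}-3\,\mathfrak{m}_{4,1^2}$$ does not belong to $\mathfrak{S}_6$.
   Context: For a partition $\lambda\vdash 6$, $\mathfrak{m}_\lambda$ denotes a formal basis symbol; a limit form $\sum_{\lambda\vdash 6}c_\lambda\mathfrak{m}_\lambda$ is identified with its coefficient vector $c=(c_\lambda)_{\lambda\vdash 6}$. Exponents in a partition denote repeated parts, e.g. $(4,1^2)=(4,1,1)$. For $n,r\ge 1$ let $p_r^{(n)}=\frac{1}{n}(x_1^r+\dots+x_n^r)\in\mathbb{R}[x_1,\dots,x_n]$ and $p_\lambda^{(n)}=\prod_i p_{\lambda_i}^{(n)}$. $\mathfrak{S}_6$ (resp. $\mathfrak{P}_6$) is the set of coefficient vectors $c$ such that $\sum_{\lambda\vdash 6}c_\lambda p_\lambda^{(n)}$ is a sum of squares of real polynomials (resp. is nonnegative on $\mathbb{R}^n$) for every $n\ge 6$. *)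

theory Defs
  imports Complex_Main "HOL-Library.Multiset" "HOL-Library.Poly_Mapping"
begin

text \<open>
  A real polynomial is a finitely supported map from monomials (finitely supported exponent
  vectors) to coefficients; the ring structure is the convolution product of
  \<^theory>\<open>HOL-Library.Poly_Mapping\<close>. The variable of index \<open>i\<close> is the exponent
  vector \<open>single i 1\<close>.
\<close>

type_synonym rpoly = "(nat \<Rightarrow>\<^sub>0 nat) \<Rightarrow>\<^sub>0 real"

definition Const :: "real \<Rightarrow> rpoly" where
  "Const a = Poly_Mapping.single 0 a"

definition X :: "nat \<Rightarrow> rpoly" where
  "X i = Poly_Mapping.single (Poly_Mapping.single i 1) 1"

text \<open>The ring \<open>R[x_1, ..., x_n]\<close>, as the polynomials involving only these variables.\<close>

definition polys :: "nat \<Rightarrow> rpoly set" where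
  "polys n = {p. \<forall>m\<in>Poly_Mapping.keys p. Poly_Mapping.keys m \<subseteq> {1..n}}"

definition poly_eval :: "(nat \<Rightarrow> real) \<Rightarrow> rpoly \<Rightarrow> real" where
  "poly_eval x p =
     (\<Sum>m\<in>Poly_Mapping.keys p. Poly_Mapping.lookup p m *
        (\<Prod>i\<in>Poly_Mapping.keys m. x i ^ Poly_Mapping.lookup m i))"

definition sum_of_squares :: "nat \<Rightarrow> rpoly \<Rightarrow> bool" where
  "sum_of_squares n f \<longleftrightarrow> (\<exists>qs. set qs \<subseteq> polys n \<and> f = (\<Sum>q\<leftarrow>qs. q ^ 2))"

text \<open>
  Meant for \<open>f\<close> in \<open>polys n\<close>: the value then depends on \<open>x 1, ..., x n\<close> only, so that
  quantifying over all \<open>x\<close> is quantifying over the points of real \<open>n\<close>-space.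
\<close>

definition nonnegative_poly :: "rpoly \<Rightarrow> bool" where
  "nonnegative_poly f \<longleftrightarrow> (\<forall>x. poly_eval x f \<ge> 0)"

definition power_mean :: "nat \<Rightarrow> nat \<Rightarrow> rpoly" where
  "power_mean n r = Const (1 / real n) * (\<Sum>i=1..n. X i ^ r)"

definition power_mean_part :: "nat \<Rightarrow> nat multiset \<Rightarrow> rpoly" where
  "power_mean_part n \<mu> = (\<Prod>r\<in>#\<mu>. power_mean n r)"

definition partitions :: "nat \<Rightarrow> nat multiset set" where
  "partitions d = {\<mu>. 0 \<notin># \<mu> \<and> sum_mset \<mu> = d}"

lemma finite_partitions: "finite (partitions d)"
proof -
  have "partitions d \<subseteq> mset ` {xs. set xs \<subseteq> {..d} \<and> length xs \<le> d}"
  proof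
    fix \<mu> assume l: "\<mu> \<in> partitions d"
    obtain xs where xs: "mset xs = \<mu>" using ex_mset by blast
    have z: "0 \<notin> set xs" and s: "sum_list xs = d"
      using l xs by (auto simp: partitions_def sum_mset_sum_list)
    have "length ys \<le> sum_list ys" if "0 \<notin> set ys" for ys :: "nat list"
      using that by (induction ys) auto
    with z s have "length xs \<le> d" by blast
    moreover have "set xs \<subseteq> {..d}" using s member_le_sum_list by fastforce
    ultimately show "\<mu> \<in> mset ` {xs. set xs \<subseteq> {..d} \<and> length xs \<le> d}"
      using xs by blast
  qed
  then show ?thesis
    by (rule finite_subset) (intro finite_imageI finite_lists_length_le finite_atMost)
qed

text \<open>
  A limit form is a formal real combination of symbols indexed by partitions, i.e. a finitely
  supported coefficient map; \<open>limit_term a \<mu>\<close> is the scalar multiple \<open>a m_\<mu>\<close>.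
\<close>

type_synonym limit_form = "nat multiset \<Rightarrow>\<^sub>0 real"

definition limit_term :: "real \<Rightarrow> nat multiset \<Rightarrow> limit_form" where
  "limit_term a \<mu> = Poly_Mapping.single \<mu> a"

definition limit_forms :: "nat \<Rightarrow> limit_form set" where
  "limit_forms d = {c. Poly_Mapping.keys c \<subseteq> partitions d}"

definition finite_form :: "nat \<Rightarrow> nat \<Rightarrow> limit_form \<Rightarrow> rpoly" where
  "finite_form d n c =
     (\<Sum>\<mu>\<in>partitions d. Const (Poly_Mapping.lookup c \<mu>) * power_mean_part n \<mu>)"

definition limit_sos :: "nat \<Rightarrow> limit_form set" where
  "limit_sos d = {c \<in> limit_forms d. \<forall>n\<ge>d. sum_of_squares n (finite_form d n c)}"

definition limit_nonneg :: "nat \<Rightarrow> limit_form set" where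
  "limit_nonneg d = {c \<in> limit_forms d. \<forall>n\<ge>d. nonnegative_poly (finite_form d n c)}"

end

(*
  Nonnegativity is the AM-GM inequality together with p_4^2 <= p_6 p_2.

  For the second part, suppose that f (in n = 10^6 variables) is a sum of squares of q_k. Since
  q_k(tx)^2 <= t^6 f(x), every q_k is a cubic form. Averaging over permutations of the variables
  makes the Gram matrix of the coefficient vectors v_m = (coefficient of the monomial m in q_k)_k
  invariant under permutations. At a sign vector with coordinate sum about n / sqrt 2 the form f
  almost vanishes, and it still does after one sign is flipped. So all q_k are small at both
  points, which forces |v_{iij}|^2 = o(n^-2). The coefficient of x_i^4 x_j^2 in f then gives
  2 <v_{iii}, v_{ijj}> ~ n^-2 / 2. Hence the v_{ijj}, for fixed i and varying j, have a common
  component and are positively correlated, whereas the tiny coefficient of x_i^2 x_j^2 x_k^2 in f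
  makes <v_{ijj}, v_{ikk}> essentially nonpositive.
*)
theory Submission
  imports Defs "HOL-Analysis.Convex" "HOL-Combinatorics.Permutations"
    "HOL-Computational_Algebra.Polynomial"
begin

section \<open>Evaluation of polynomials and of limit forms\<close>

definition monom_eval :: "(nat \<Rightarrow> real) \<Rightarrow> (nat \<Rightarrow>\<^sub>0 nat) \<Rightarrow> real" where
  "monom_eval x m = (\<Prod>i\<in>Poly_Mapping.keys m. x i ^ Poly_Mapping.lookup m i)"

lemma monom_eval_superset:
  assumes "finite A" "Poly_Mapping.keys m \<subseteq> A"
  shows "monom_eval x m = (\<Prod>i\<in>A. x i ^ Poly_Mapping.lookup m i)"
  unfolding monom_eval_def using assms
  by (intro prod.mono_neutral_left) (auto simp: in_keys_iff)

lemma monom_eval_0 [simp]: "monom_eval x 0 = 1"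
  by (simp add: monom_eval_def)

lemma monom_eval_single [simp]: "monom_eval x (Poly_Mapping.single i k) = x i ^ k"
  by (simp add: monom_eval_def)

lemma monom_eval_add: "monom_eval x (m + m') = monom_eval x m * monom_eval x m'"
proof -
  let ?A = "Poly_Mapping.keys m \<union> Poly_Mapping.keys m'"
  have "Poly_Mapping.keys (m + m') \<subseteq> ?A" by (rule keys_add)
  then show ?thesis
    by (simp add: monom_eval_superset[of ?A] lookup_add power_add prod.distrib)
qed

lemma poly_eval_superset:
  assumes "finite A" "Poly_Mapping.keys p \<subseteq> A"
  shows "poly_eval x p = (\<Sum>m\<in>A. Poly_Mapping.lookup p m * monom_eval x m)"
  unfolding poly_eval_def monom_eval_def[symmetric] using assms
  by (intro sum.mono_neutral_left) (auto simp: in_keys_iff)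

lemma poly_eval_single [simp]: "poly_eval x (Poly_Mapping.single m a) = a * monom_eval x m"
  by (subst poly_eval_superset[of "{m}"]) (auto simp: in_keys_iff)

lemma poly_eval_0 [simp]: "poly_eval x 0 = 0"
  by (simp add: poly_eval_def)

lemma poly_eval_add: "poly_eval x (p + q) = poly_eval x p + poly_eval x q"
proof -
  let ?A = "Poly_Mapping.keys p \<union> Poly_Mapping.keys q"
  have "Poly_Mapping.keys (p + q) \<subseteq> ?A" by (rule keys_add)
  then show ?thesis
    by (simp add: poly_eval_superset[of ?A] lookup_add algebra_simps sum.distrib)
qed

lemma poly_eval_sum: "poly_eval x (\<Sum>i\<in>A. f i) = (\<Sum>i\<in>A. poly_eval x (f i))"
  by (induction A rule: infinite_finite_induct) (simp_all add: poly_eval_add)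

lemma poly_mapping_sum_singles:
  "p = (\<Sum>m\<in>Poly_Mapping.keys p. Poly_Mapping.single m (Poly_Mapping.lookup p m))"
  by (rule poly_mapping_eqI)
    (auto simp: lookup_sum lookup_single when_def sum.delta' in_keys_iff)

lemma poly_eval_mult: "poly_eval x (p * q) = poly_eval x p * poly_eval x q"
proof -
  have "p * q = (\<Sum>m\<in>Poly_Mapping.keys p. \<Sum>m'\<in>Poly_Mapping.keys q.
      Poly_Mapping.single (m + m') (Poly_Mapping.lookup p m * Poly_Mapping.lookup q m'))"
    by (subst poly_mapping_sum_singles[of p], subst poly_mapping_sum_singles[of q])
      (simp add: sum_product mult_single)
  then have "poly_eval x (p * q) = (\<Sum>m\<in>Poly_Mapping.keys p. \<Sum>m'\<in>Poly_Mapping.keys q.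
      Poly_Mapping.lookup p m * Poly_Mapping.lookup q m' * monom_eval x (m + m'))"
    by (simp only: poly_eval_sum poly_eval_single)
  also have "\<dots> = poly_eval x p * poly_eval x q"
    by (simp add: poly_eval_def monom_eval_def[symmetric] monom_eval_add sum_product mult_ac)
  finally show ?thesis .
qed

lemma poly_eval_Const [simp]: "poly_eval x (Const a) = a"
  by (simp add: Const_def)

lemma poly_eval_X [simp]: "poly_eval x (X i) = x i"
  by (simp add: X_def)

lemma poly_eval_1 [simp]: "poly_eval x 1 = 1"
  using poly_eval_Const[of x 1] by (simp add: Const_def)

lemma poly_eval_power: "poly_eval x (p ^ k) = poly_eval x p ^ k"
  by (induction k) (simp_all add: poly_eval_mult)

definition pmean :: "nat \<Rightarrow> nat \<Rightarrow> (nat \<Rightarrow> real) \<Rightarrow> real" where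
  "pmean n r x = (\<Sum>i=1..n. x i ^ r) / real n"

lemma poly_eval_power_mean: "poly_eval x (power_mean n r) = pmean n r x"
  by (simp add: power_mean_def pmean_def poly_eval_mult poly_eval_sum poly_eval_power)

lemma poly_eval_power_mean_part:
  "poly_eval x (power_mean_part n \<mu>) = (\<Prod>r\<in>#\<mu>. pmean n r x)"
  unfolding power_mean_part_def
  by (induction \<mu>) (simp_all add: poly_eval_mult poly_eval_power_mean)

definition four_term_form :: "real \<Rightarrow> real \<Rightarrow> real \<Rightarrow> limit_form" where
  "four_term_form a b c = limit_term a {#6#} + limit_term b {#4, 2#}
     + limit_term c {#1, 1, 1, 1, 1, 1#} - limit_term 3 {#4, 1, 1#}"

lemma keys_four_term_form:
  "Poly_Mapping.keys (four_term_form a b c) \<subseteq> {{#6#}, {#4, 2#}, {#1, 1, 1, 1, 1, 1#}, {#4, 1, 1#}}"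
  by (auto simp: four_term_form_def limit_term_def in_keys_iff lookup_add lookup_minus
      lookup_single when_def split: if_splits)

lemma four_term_form_limit_forms: "four_term_form a b c \<in> limit_forms 6"
  using keys_four_term_form[of a b c] by (auto simp: limit_forms_def partitions_def)

lemma poly_eval_four_term_form:
  "poly_eval x (finite_form 6 n (four_term_form a b c)) =
     a * pmean n 6 x + b * (pmean n 4 x * pmean n 2 x) + c * pmean n 1 x ^ 6
       - 3 * (pmean n 4 x * pmean n 1 x ^ 2)"
proof -
  let ?P = "{{#6#}, {#4, 2#}, {#1, 1, 1, 1, 1, 1#}, {#4, 1, 1#}} :: nat multiset set"
  let ?t = "\<lambda>\<mu>. Poly_Mapping.lookup (four_term_form a b c) \<mu> * (\<Prod>r\<in>#\<mu>. pmean n r x)"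
  \<comment> \<open>The four partitions have 1, 2, 6 and 3 parts, so sizes alone tell the keys
    apart.\<close>
  have neq: "(A = B) = False" if "size A \<noteq> size B" for A B :: "nat multiset"
    using that by auto
  have "poly_eval x (finite_form 6 n (four_term_form a b c)) = sum ?t (partitions 6)"
    by (simp add: finite_form_def poly_eval_sum poly_eval_mult poly_eval_power_mean_part)
  also have "\<dots> = sum ?t ?P"
    using keys_four_term_form[of a b c]
    by (intro sum.mono_neutral_right finite_partitions)
      (auto simp: partitions_def in_keys_iff)
  also have "\<dots> = a * pmean n 6 x + b * (pmean n 4 x * pmean n 2 x) + c * pmean n 1 x ^ 6
       - 3 * (pmean n 4 x * pmean n 1 x ^ 2)"
    by (simp add: four_term_form_def limit_term_def lookup_add lookup_minus lookup_single
        when_def neq power2_eq_square numeral_eq_Suc)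
  finally show ?thesis .
qed

section \<open>Nonnegativity\<close>

lemma pmean_even_nonneg: "even r \<Longrightarrow> pmean n r x \<ge> 0"
  by (auto simp: pmean_def intro!: divide_nonneg_nonneg sum_nonneg)

text \<open>Cauchy-Schwarz for the vectors of the x_i^3 and of the x_i.\<close>

lemma pmean_4_squared_le: "pmean n 4 x ^ 2 \<le> pmean n 6 x * pmean n 2 x"
proof -
  have "(\<Sum>i=1..n. x i ^ 3 * x i) ^ 2 \<le> (\<Sum>i=1..n. (x i ^ 3) ^ 2) * (\<Sum>i=1..n. x i ^ 2)"
    by (rule Cauchy_Schwarz_ineq_sum)
  then show ?thesis
    by (simp add: pmean_def power_divide power2_eq_square divide_right_mono
        flip: power_mult power_Suc2 power_add)
qed

text \<open>AM-GM for three numbers, stated through t^3 so that no cube root occurs and t may have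
  any sign.\<close>

lemma amgm3:
  fixes u v w t :: real
  assumes "u \<ge> 0" "v \<ge> 0" "w \<ge> 0" "t ^ 3 \<le> u * v * w"
  shows "3 * t \<le> u + v + w"
proof -
  have "27 * (u * v * w) \<le> (u + v + w) ^ 3"
  proof -
    \<comment> \<open>The first summand is u^3 + v^3 + w^3 - 3uvw; the second is three times the
      excess of the six products of type u^2 v over 6uvw.\<close>
    have "(u + v + w) ^ 3 - 27 * (u * v * w) =
        (u + v + w) * ((u - v) ^ 2 + (v - w) ^ 2 + (w - u) ^ 2) / 2
        + 3 * (u * (v - w) ^ 2 + v * (w - u) ^ 2 + w * (u - v) ^ 2)"
      by (simp add: power2_eq_square power3_eq_cube field_simps)
    also have "\<dots> \<ge> 0"
      using assms by (intro add_nonneg_nonneg divide_nonneg_nonneg mult_nonneg_nonneg) auto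
    finally show ?thesis by simp
  qed
  then have "(3 * t) ^ 3 \<le> (u + v + w) ^ 3"
    using assms(4) by (simp add: power_mult_distrib)
  then show ?thesis
    using assms(1-3) power_less_imp_less_base[of "u+v+w" 3 "3*t"] power_strict_mono[of "u+v+w" "3*t" 3]
    by (meson add_nonneg_nonneg linorder_not_less zero_less_numeral)
qed

text \<open>AM-GM for the three terms with coefficients a, b, c: since abc = 1, their product is p_6
  p_4 p_2 p_1^6, which dominates the cube of p_4 p_1^2 because p_4^2 \<le> p_6 p_2.\<close>

lemma four_term_form_nonneg:
  assumes "a \<ge> 0" "b \<ge> 0" "c \<ge> 0" "a * b * c = 1"
  shows "four_term_form a b c \<in> limit_nonneg 6"
proof -
  have "poly_eval x (finite_form 6 n (four_term_form a b c)) \<ge> 0" for n x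
  proof -
    let ?p = "\<lambda>r. pmean n r x"
    have "(?p 4 * ?p 1 ^ 2) ^ 3 = ?p 4 ^ 2 * (?p 4 * ?p 1 ^ 6)"
      by (simp add: power_mult_distrib power_numeral_reduce flip: power_mult)
    also have "\<dots> \<le> ?p 6 * ?p 2 * (?p 4 * ?p 1 ^ 6)"
      by (intro mult_right_mono pmean_4_squared_le mult_nonneg_nonneg pmean_even_nonneg) auto
    also have "\<dots> = (a * b * c) * (?p 6 * ?p 2 * (?p 4 * ?p 1 ^ 6))"
      using assms(4) by simp
    also have "\<dots> = (a * ?p 6) * (b * (?p 4 * ?p 2)) * (c * ?p 1 ^ 6)"
      by (simp add: mult_ac)
    finally have "3 * (?p 4 * ?p 1 ^ 2) \<le> a * ?p 6 + b * (?p 4 * ?p 2) + c * ?p 1 ^ 6"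
      using assms(1-3)
      by (intro amgm3 mult_nonneg_nonneg pmean_even_nonneg) auto
    then show ?thesis by (simp add: poly_eval_four_term_form)
  qed
  then show ?thesis
    by (simp add: limit_nonneg_def nonnegative_poly_def four_term_form_limit_forms)
qed

section \<open>Squares dominated by a sextic come from cubic forms\<close>

lemma poly_nonneg_at_0:
  fixes Q :: "real poly"
  assumes "\<And>t. t \<noteq> 0 \<Longrightarrow> poly Q t \<ge> 0"
  shows "poly Q 0 \<ge> 0"
proof -
  have "(poly Q \<longlongrightarrow> poly Q 0) (at 0)"
    using poly_isCont[where p = Q and x = 0] unfolding isCont_def .
  then show ?thesis
    by (rule tendsto_lowerbound) (use assms in \<open>auto simp: eventually_at_filter\<close>)
qed

text \<open>The bound forces P(0) = 0, and a factor t^2 cancels for t \<noteq> 0. At t = 0 the new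
  bound holds by continuity, so the step can be repeated.\<close>

lemma poly_square_le_divide_X:
  fixes P :: "real poly"
  assumes "\<And>t. poly P t ^ 2 \<le> C * t ^ (2 * Suc k)"
  obtains R where "P = pCons 0 R" "\<And>t. poly R t ^ 2 \<le> C * t ^ (2 * k)"
proof -
  obtain a R where P: "P = pCons a R" by (cases P)
  have "a = 0" using assms[of 0] by (simp add: P)
  have "poly (monom C (2 * k) - R ^ 2) t \<ge> 0" if "t \<noteq> 0" for t
  proof -
    have "t ^ 2 * poly R t ^ 2 \<le> t ^ 2 * (C * t ^ (2 * k))"
      using assms[of t] by (simp add: P \<open>a = 0\<close> power_mult_distrib mult_ac power2_eq_square)
    then show ?thesis using that by (simp add: poly_monom)
  qed
  then have "poly (monom C (2 * k) - R ^ 2) t \<ge> 0" for t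
    using poly_nonneg_at_0[of "monom C (2 * k) - R ^ 2"] by (cases "t = 0") auto
  then show ?thesis
    using that[of R] by (simp add: P \<open>a = 0\<close> poly_monom)
qed

text \<open>A nonconstant polynomial is unbounded at infinity.\<close>

lemma bounded_poly_degree_0:
  fixes R :: "real poly"
  assumes "\<And>t. poly R t ^ 2 \<le> C"
  shows "degree R = 0"
proof (rule ccontr)
  assume "degree R \<noteq> 0"
  then have "filterlim (poly R) at_infinity at_infinity"
    by (intro filterlim_poly_at_infinity) simp
  then have "eventually (\<lambda>t. \<bar>C\<bar> + 1 \<le> norm (poly R t)) at_infinity"
    by (subst (asm) filterlim_at_infinity[of 0]) auto
  then obtain b where b: "\<And>t. b \<le> \<bar>t\<bar> \<Longrightarrow> \<bar>C\<bar> + 1 \<le> \<bar>poly R t\<bar>"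
    by (auto simp: eventually_at_infinity)
  define t where "t = \<bar>b\<bar>"
  have t: "\<bar>C\<bar> + 1 \<le> \<bar>poly R t\<bar>" by (rule b) (simp add: t_def)
  have "C < (\<bar>C\<bar> + 1) ^ 2" by (smt (verit) power2_eq_square mult_less_cancel_right1 mult_nonneg_nonneg distrib_left mult.commute mult_1 abs_ge_self abs_ge_zero)
  also have "\<dots> \<le> \<bar>poly R t\<bar> ^ 2" using t by (intro power_mono) auto
  finally show False using assms[of t] by simp
qed

text \<open>Three divisions by the variable leave a polynomial whose square is at most C, hence a
  constant.\<close>

lemma poly_square_le_power6:
  fixes P :: "real poly"
  assumes "\<And>t. poly P t ^ 2 \<le> C * t ^ 6"
  shows "P = monom (coeff P 3) 3"
proof -
  from assms have "\<And>t. poly P t ^ 2 \<le> C * t ^ (2 * Suc 2)" by simp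
  then obtain R where R: "P = pCons 0 R" "\<And>t. poly R t ^ 2 \<le> C * t ^ (2 * Suc 1)"
    by (rule poly_square_le_divide_X) (auto simp: numeral_eq_Suc)
  from R(2) obtain R' where R': "R = pCons 0 R'" "\<And>t. poly R' t ^ 2 \<le> C * t ^ (2 * Suc 0)"
    by (rule poly_square_le_divide_X) (auto simp: numeral_eq_Suc)
  from R'(2) obtain R'' where R'': "R' = pCons 0 R''" "\<And>t. poly R'' t ^ 2 \<le> C * t ^ (2 * 0)"
    by (rule poly_square_le_divide_X) (auto simp: numeral_eq_Suc)
  from R''(2) have "degree R'' = 0"
    by (intro bounded_poly_degree_0[of _ C]) simp
  then obtain c where "R'' = [:c:]" by (rule degree_eq_zeroE)
  then show ?thesis
    by (simp add: R R' R'' monom_altdef numeral_eq_Suc)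
qed

section \<open>Degrees of monomials and polarization of cubic forms\<close>

definition mdeg :: "(nat \<Rightarrow>\<^sub>0 nat) \<Rightarrow> nat" where
  "mdeg m = (\<Sum>i\<in>Poly_Mapping.keys m. Poly_Mapping.lookup m i)"

lemma mdeg_add: "mdeg (m + m') = mdeg m + mdeg m'"
  unfolding mdeg_def by (rule setsum_keys_plus_distrib) auto

lemma mdeg_single [simp]: "mdeg (Poly_Mapping.single i k) = k"
  by (simp add: mdeg_def)

lemma mdeg_eq_0_iff: "mdeg m = 0 \<longleftrightarrow> m = 0"
  by (auto simp: mdeg_def in_keys_iff intro: poly_mapping_eqI)

lemma monom_eval_scale: "monom_eval (\<lambda>i. t * x i) m = t ^ mdeg m * monom_eval x m"
  by (simp add: monom_eval_def mdeg_def power_mult_distrib prod.distrib power_sum)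

lemma mdeg_SucE:
  assumes "mdeg m = Suc d"
  obtains i m' where "m = Poly_Mapping.single i 1 + m'" "mdeg m' = d"
proof -
  from assms have "m \<noteq> 0" using mdeg_eq_0_iff[of m] by simp
  then obtain i where i: "Poly_Mapping.lookup m i \<noteq> 0"
    by (metis poly_mapping_eqI lookup_zero)
  define m' where "m' = m - Poly_Mapping.single i 1"
  have "m = Poly_Mapping.single i 1 + m'"
    using i by (intro poly_mapping_eqI)
      (auto simp: m'_def lookup_add lookup_minus lookup_single when_def)
  moreover from this assms have "mdeg m' = d"
    by (metis mdeg_add mdeg_single add_Suc plus_1_eq_Suc nat.inject add_0)
  ultimately show ?thesis by (rule that)
qed

lemma mdeg_3E:
  assumes "mdeg m = 3"
  shows "\<exists>i j k. m = Poly_Mapping.single i 1 + (Poly_Mapping.single j 1 + Poly_Mapping.single k 1)"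
proof -
  have "mdeg m = Suc (Suc (Suc 0))" using assms by simp
  then obtain i m1 where 1: "m = Poly_Mapping.single i 1 + m1" "mdeg m1 = Suc (Suc 0)"
    by (rule mdeg_SucE)
  from 1(2) obtain j m2 where 2: "m1 = Poly_Mapping.single j 1 + m2" "mdeg m2 = Suc 0"
    by (rule mdeg_SucE)
  from 2(2) obtain k m3 where 3: "m2 = Poly_Mapping.single k 1 + m3" "mdeg m3 = 0"
    by (rule mdeg_SucE)
  show ?thesis using 1 2 3 by (auto simp: mdeg_eq_0_iff)
qed

text \<open>Linearity is demanded in the first argument; the two exchanges of arguments carry it to
  the others.\<close>

definition symmetric_trilinear ::
    "((nat \<Rightarrow> real) \<Rightarrow> (nat \<Rightarrow> real) \<Rightarrow> (nat \<Rightarrow> real) \<Rightarrow> real) \<Rightarrow> bool" where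
  "symmetric_trilinear T \<longleftrightarrow>
     (\<forall>x y z. T x y z = T y x z) \<and> (\<forall>x y z. T x y z = T x z y) \<and>
     (\<forall>x x' y z. T (\<lambda>i. x i + x' i) y z = T x y z + T x' y z) \<and>
     (\<forall>c x y z. T (\<lambda>i. c * x i) y z = c * T x y z)"

text \<open>On each line through the origin \<open>q\<close> is a polynomial in t whose square is at
  most a multiple of t^6, so only the monomials of degree 3 contribute to its values, and these can
  be polarized.\<close>

lemma cubic_growth_imp_trilinear:
  assumes "\<And>x t. poly_eval (\<lambda>i. t * x i) q ^ 2 \<le> F x * t ^ 6"
  shows "\<exists>T. symmetric_trilinear T \<and> (\<forall>x. poly_eval x q = T x x x)"
proof -
  define M where "M = {m \<in> Poly_Mapping.keys q. mdeg m = 3}"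
  let ?c = "Poly_Mapping.lookup q"
  have [simp]: "finite M" by (simp add: M_def)
  have eval: "poly_eval x q = (\<Sum>m\<in>M. ?c m * monom_eval x m)" for x
  proof -
    define P where "P = (\<Sum>m\<in>Poly_Mapping.keys q. monom (?c m * monom_eval x m) (mdeg m))"
    have P: "poly P t = poly_eval (\<lambda>i. t * x i) q" for t
      unfolding P_def poly_eval_def monom_eval_def[symmetric] monom_eval_scale
      by (simp add: poly_sum poly_monom mult_ac)
    have "P = monom (coeff P 3) 3"
      using assms by (intro poly_square_le_power6[of _ "F x"]) (simp add: P)
    then have "poly P 1 = coeff P 3"
      by (metis poly_monom power_one mult.right_neutral)
    also have "\<dots> = (\<Sum>m\<in>M. ?c m * monom_eval x m)"
      unfolding P_def M_def coeff_sum by (simp add: sum.inter_filter if_distrib cong: if_cong)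
    finally show ?thesis by (simp add: P)
  qed
  have "\<forall>m\<in>M. \<exists>i j k. m = Poly_Mapping.single i 1 + (Poly_Mapping.single j 1 + Poly_Mapping.single k 1)"
    unfolding M_def using mdeg_3E by blast
  then obtain i j k where ijk:
    "\<And>m. m \<in> M \<Longrightarrow> m = Poly_Mapping.single (i m) 1 + (Poly_Mapping.single (j m) 1 + Poly_Mapping.single (k m) 1)"
    by metis
  have mono: "monom_eval x m = x (i m) * x (j m) * x (k m)" if "m \<in> M" for x m
    by (subst ijk[OF that]) (simp add: monom_eval_add)
  \<comment> \<open>Each cubic monomial is polarized by averaging over the six assignments of x, y,
    z to its three variables.\<close>
  define T where "T = (\<lambda>x y z :: nat \<Rightarrow> real. \<Sum>m\<in>M. ?c m / 6 *
     (x (i m) * y (j m) * z (k m) + x (i m) * z (j m) * y (k m) + y (i m) * x (j m) * z (k m)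
      + y (i m) * z (j m) * x (k m) + z (i m) * x (j m) * y (k m) + z (i m) * y (j m) * x (k m)))"
  have "symmetric_trilinear T"
    unfolding symmetric_trilinear_def T_def
    by (auto simp: sum_distrib_left sum.distrib[symmetric] algebra_simps intro!: sum.cong)
  moreover have "poly_eval x q = T x x x" for x
    unfolding T_def eval by (intro sum.cong) (auto simp: mono)
  ultimately show ?thesis by blast
qed

section \<open>Symmetric families of cubic forms\<close>

declare One_nat_def [simp del]

lemma symmetric_trilinearD:
  assumes "symmetric_trilinear T"
  shows "T x y z = T y x z" "T x y z = T x z y"
    "T (\<lambda>i. x i + x' i) y z = T x y z + T x' y z"
    "T x (\<lambda>i. y i + x' i) z = T x y z + T x x' z"
    "T x y (\<lambda>i. z i + x' i) = T x y z + T x y x'"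
    "T (\<lambda>i. c * x i) y z = c * T x y z"
    "T x (\<lambda>i. c * y i) z = c * T x y z"
    "T x y (\<lambda>i. c * z i) = c * T x y z"
  using assms unfolding symmetric_trilinear_def by metis+

lemma symmetric_trilinear_sum:
  assumes T: "symmetric_trilinear T" and "finite A"
  shows "T x y (\<lambda>i. \<Sum>j\<in>A. c j * f j i) = (\<Sum>j\<in>A. c j * T x y (f j))"
  using \<open>finite A\<close>
proof induction
  case empty
  show ?case using symmetric_trilinearD(8)[OF T, of x y 0 "\<lambda>_. 0"] by simp
next
  case (insert a A)
  then show ?case by (simp add: symmetric_trilinearD(5,8)[OF T])
qed

lemma trilinear_cube_expand:
  assumes T: "symmetric_trilinear T"
  shows "T (\<lambda>i. u i + s * e i) (\<lambda>i. u i + s * e i) (\<lambda>i. u i + s * e i) =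
    T u u u + 3 * s * T u u e + 3 * s ^ 2 * T e e u + s ^ 3 * T e e e"
proof -
  note D = symmetric_trilinearD[OF T]
  have "T u e u = T u u e" "T e u u = T u u e" "T u e e = T e e u" "T e u e = T e e u"
    using D(1,2) by metis+
  then show ?thesis
    by (simp add: D(3-8) power2_eq_square power3_eq_cube algebra_simps)
qed

lemma trilinear_square_expand:
  assumes T: "symmetric_trilinear T"
  shows "T (\<lambda>i. s * u i + v i) (\<lambda>i. s * u i + v i) e =
    s ^ 2 * T u u e + 2 * s * T u v e + T v v e"
proof -
  note D = symmetric_trilinearD[OF T]
  have "T v u e = T u v e" using D(1,2) by metis
  then show ?thesis
    by (simp add: D(3-8) power2_eq_square algebra_simps)
qed

text \<open>Seven points determine a polynomial of degree at most 6, and the seven equations are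
  linear in the coefficients.\<close>

lemma even_coeffs_eq:
  fixes c0 :: real
  assumes "\<And>s. c0 + c1 * s + c2 * s ^ 2 + c3 * s ^ 3 + c4 * s ^ 4 + c5 * s ^ 5 + c6 * s ^ 6 =
    d0 + d1 * s + d2 * s ^ 2 + d3 * s ^ 3 + d4 * s ^ 4 + d5 * s ^ 5 + d6 * s ^ 6"
  shows "c2 = d2" "c4 = d4" "c6 = d6"
  using assms[of 0] assms[of 1] assms[of "-1"] assms[of 2] assms[of "-2"] assms[of 3] assms[of "-3"]
  by simp_all

text \<open>The vectors \<open>t j\<close>, with coordinates indexed by \<open>I\<close>, have Gram
  matrix (g - h) Id + h J, where J is the all-ones matrix; this is its quadratic form at
  \<open>y\<close>. Permutation invariance produces such matrices below.\<close>

lemma sum_square_sum_const_gram: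
  fixes t :: "'b \<Rightarrow> 'a \<Rightarrow> real"
  assumes "finite A"
    and diag: "\<And>j. j \<in> A \<Longrightarrow> (\<Sum>\<iota>\<in>I. t j \<iota> ^ 2) = g"
    and off: "\<And>j l. j \<in> A \<Longrightarrow> l \<in> A \<Longrightarrow> j \<noteq> l \<Longrightarrow> (\<Sum>\<iota>\<in>I. t j \<iota> * t l \<iota>) = h"
  shows "(\<Sum>\<iota>\<in>I. (\<Sum>j\<in>A. y j * t j \<iota>) ^ 2) = (g - h) * (\<Sum>j\<in>A. y j ^ 2) + h * (\<Sum>j\<in>A. y j) ^ 2"
proof -
  have "(\<Sum>\<iota>\<in>I. (\<Sum>j\<in>A. y j * t j \<iota>) ^ 2)
      = (\<Sum>\<iota>\<in>I. \<Sum>j\<in>A. \<Sum>l\<in>A. y j * y l * (t j \<iota> * t l \<iota>))"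
    by (simp add: power2_eq_square sum_product mult_ac)
  also have "\<dots> = (\<Sum>j\<in>A. \<Sum>l\<in>A. y j * y l * (\<Sum>\<iota>\<in>I. t j \<iota> * t l \<iota>))"
    by (subst sum.swap, intro sum.cong refl, subst sum.swap) (simp add: sum_distrib_left)
  also have "\<dots> = (\<Sum>j\<in>A. \<Sum>l\<in>A. (if l = j then (g - h) * y j ^ 2 else 0) + h * (y j * y l))"
    using diag off by (intro sum.cong refl) (auto simp: power2_eq_square algebra_simps)
  also have "\<dots> = (g - h) * (\<Sum>j\<in>A. y j ^ 2) + h * (\<Sum>j\<in>A. y j) ^ 2"
    using \<open>finite A\<close>
    by (simp add: sum.distrib sum_distrib_left[symmetric] sum_distrib_right[symmetric]
        power2_eq_square)
  finally show ?thesis .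
qed

section \<open>The form and its restriction to lines in the first coordinate direction\<close>

definition ev :: "nat \<Rightarrow> nat \<Rightarrow> real" where
  "ev j = (\<lambda>i. if i = j then 1 else 0)"

lemma ev_comp: "bij p \<Longrightarrow> p b = a \<Longrightarrow> ev a \<circ> p = ev b"
  by (auto simp: ev_def fun_eq_iff bij_def inj_eq)

text \<open>At a sign vector the even power means are 1, so the value is 1 + 4s^3 - 3s = (s + 1)(2s
  - 1)^2 with s = p_1^2. The double zero at s = 1/2 is what the proof exploits.\<close>

definition mean_form :: "nat \<Rightarrow> (nat \<Rightarrow> real) \<Rightarrow> real" where
  "mean_form n x = 1/2 * pmean n 6 x + 1/2 * (pmean n 4 x * pmean n 2 x)
     + 4 * pmean n 1 x ^ 6 - 3 * (pmean n 4 x * pmean n 1 x ^ 2)"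

text \<open>The first coordinate is left out because it varies separately, along the line u + s
  e.\<close>

definition psum :: "nat \<Rightarrow> nat \<Rightarrow> (nat \<Rightarrow> real) \<Rightarrow> real" where
  "psum n r u = (\<Sum>i=2..n. u i ^ r)"

lemma pmean_add_ev:
  assumes "u 1 = 0" "r > 0" "n \<ge> 1"
  shows "pmean n r (\<lambda>i. u i + s * ev 1 i) = (psum n r u + s ^ r) / real n"
proof -
  have "(\<Sum>i=1..n. (u i + s * ev 1 i) ^ r) = s ^ r + (\<Sum>i=Suc 1..n. (u i + s * ev 1 i) ^ r)"
    using assms by (subst sum.atLeast_Suc_atMost) (auto simp: ev_def)
  also have "(\<Sum>i=Suc 1..n. (u i + s * ev 1 i) ^ r) = psum n r u"
    unfolding psum_def by (intro sum.cong) (auto simp: ev_def)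
  finally show ?thesis by (simp add: pmean_def)
qed

lemma mean_form_add_ev:
  assumes "u 1 = 0" "n \<ge> 1"
  shows "mean_form n (\<lambda>i. u i + s * ev 1 i) =
    1/2 * ((psum n 6 u + s ^ 6) / real n)
    + 1/2 * ((psum n 4 u + s ^ 4) / real n * ((psum n 2 u + s ^ 2) / real n))
    + 4 * ((psum n 1 u + s) / real n) ^ 6
    - 3 * ((psum n 4 u + s ^ 4) / real n * ((psum n 1 u + s) / real n) ^ 2)"
  unfolding mean_form_def using assms by (simp add: pmean_add_ev)

text \<open>Abstracts a sum of squares averaged over permutations. By \<open>permute\<close>, the
  inner products over \<iota> of the vectors \<open>T \<iota> x y z\<close> are invariant; the
  single forms need not be symmetric.\<close>

locale symmetric_cubic_family =
  fixes I :: "'a set" and T :: "'a \<Rightarrow> (nat \<Rightarrow> real) \<Rightarrow> (nat \<Rightarrow> real) \<Rightarrow> (nat \<Rightarrow> real) \<Rightarrow> real"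
    and n :: nat
  assumes trilinear: "\<And>\<iota>. symmetric_trilinear (T \<iota>)"
    and square_sum: "\<And>x. (\<Sum>\<iota>\<in>I. T \<iota> x x x ^ 2) = mean_form n x"
    and permute: "\<And>p x y z x' y' z'. p permutes {1..n} \<Longrightarrow>
      (\<Sum>\<iota>\<in>I. T \<iota> (x \<circ> p) (y \<circ> p) (z \<circ> p) * T \<iota> (x' \<circ> p) (y' \<circ> p) (z' \<circ> p)) =
      (\<Sum>\<iota>\<in>I. T \<iota> x y z * T \<iota> x' y' z')"
    and n_ge: "n \<ge> 3"
begin

lemmas D = symmetric_trilinearD[OF trilinear]

abbreviation e :: "nat \<Rightarrow> real" where "e \<equiv> ev 1"

lemma permute_ev:
  assumes "p permutes {1..n}"
  shows "(\<Sum>\<iota>\<in>I. T \<iota> (ev (p a)) (ev (p b)) (ev (p c)) * T \<iota> (ev (p a')) (ev (p b')) (ev (p c')))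
     = (\<Sum>\<iota>\<in>I. T \<iota> (ev a) (ev b) (ev c) * T \<iota> (ev a') (ev b') (ev c'))"
proof -
  have "ev (p d) \<circ> p = ev d" for d
    using permutes_bij[OF assms] by (rule ev_comp) simp
  then show ?thesis
    using permute[OF assms, of "ev (p a)" "ev (p b)" "ev (p c)" "ev (p a')" "ev (p b')" "ev (p c')"]
    by simp
qed

text \<open>Along the line u + s e both sides of \<open>square_sum\<close> are polynomials of degree
  at most 6 in s. The three equations compare the coefficients of s^2, s^4 and s^6.\<close>

lemma slice_coeffs:
  assumes "u 1 = 0"
  defines "Q \<equiv> \<lambda>r. psum n r u" and "w \<equiv> 1 / real n"
  shows "9 * (\<Sum>\<iota>\<in>I. T \<iota> u u e ^ 2) + 6 * (\<Sum>\<iota>\<in>I. T \<iota> u u u * T \<iota> e e u)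
      = w ^ 2 * Q 4 / 2 + 60 * w ^ 6 * Q 1 ^ 4 - 3 * w ^ 3 * Q 4"
    and "9 * (\<Sum>\<iota>\<in>I. T \<iota> e e u ^ 2) + 6 * (\<Sum>\<iota>\<in>I. T \<iota> u u e * T \<iota> e e e)
      = w ^ 2 * Q 2 / 2 + 60 * w ^ 6 * Q 1 ^ 2 - 3 * w ^ 3 * Q 1 ^ 2"
    and "(\<Sum>\<iota>\<in>I. T \<iota> e e e ^ 2) = w / 2 + w ^ 2 / 2 + 4 * w ^ 6 - 3 * w ^ 3"
proof -
  let ?g = "\<lambda>f h. \<Sum>\<iota>\<in>I. f \<iota> * h \<iota>"
  let ?T0 = "\<lambda>\<iota>. T \<iota> u u u" and ?T1 = "\<lambda>\<iota>. T \<iota> u u e"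
    and ?T2 = "\<lambda>\<iota>. T \<iota> e e u" and ?T3 = "\<lambda>\<iota>. T \<iota> e e e"
  have *: "?g ?T0 ?T0 + (6 * ?g ?T0 ?T1) * s + (9 * ?g ?T1 ?T1 + 6 * ?g ?T0 ?T2) * s ^ 2
      + (2 * ?g ?T0 ?T3 + 18 * ?g ?T1 ?T2) * s ^ 3 + (9 * ?g ?T2 ?T2 + 6 * ?g ?T1 ?T3) * s ^ 4
      + (6 * ?g ?T2 ?T3) * s ^ 5 + ?g ?T3 ?T3 * s ^ 6 =
      (w * Q 6 / 2 + w ^ 2 * Q 4 * Q 2 / 2 + 4 * w ^ 6 * Q 1 ^ 6 - 3 * w ^ 3 * Q 4 * Q 1 ^ 2)
      + (24 * w ^ 6 * Q 1 ^ 5 - 6 * w ^ 3 * Q 4 * Q 1) * s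
      + (w ^ 2 * Q 4 / 2 + 60 * w ^ 6 * Q 1 ^ 4 - 3 * w ^ 3 * Q 4) * s ^ 2
      + (80 * w ^ 6 * Q 1 ^ 3) * s ^ 3
      + (w ^ 2 * Q 2 / 2 + 60 * w ^ 6 * Q 1 ^ 2 - 3 * w ^ 3 * Q 1 ^ 2) * s ^ 4
      + (24 * w ^ 6 * Q 1 - 6 * w ^ 3 * Q 1) * s ^ 5
      + (w / 2 + w ^ 2 / 2 + 4 * w ^ 6 - 3 * w ^ 3) * s ^ 6" (is "?L s = ?R s") for s
  proof -
    have "?L s = (\<Sum>\<iota>\<in>I. (?T0 \<iota> + 3 * s * ?T1 \<iota> + 3 * s ^ 2 * ?T2 \<iota> + s ^ 3 * ?T3 \<iota>) ^ 2)"
      unfolding sum_distrib_left sum_distrib_right sum.distrib[symmetric]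
      by (intro sum.cong refl) algebra
    also have "\<dots> = mean_form n (\<lambda>i. u i + s * e i)"
      by (simp only: square_sum[symmetric] trilinear_cube_expand[OF trilinear])
    also have "\<dots> = 1/2 * (w * (Q 6 + s ^ 6)) + 1/2 * (w * (Q 4 + s ^ 4) * (w * (Q 2 + s ^ 2)))
        + 4 * (w * (Q 1 + s)) ^ 6 - 3 * (w * (Q 4 + s ^ 4) * (w * (Q 1 + s)) ^ 2)"
      using n_ge by (subst mean_form_add_ev[of u n s, OF assms(1)]) (auto simp: Q_def w_def)
    also have "\<dots> = ?R s"
      by (simp add: field_simps power_numeral_reduce)
    finally show ?thesis .
  qed
  show "9 * (\<Sum>\<iota>\<in>I. T \<iota> u u e ^ 2) + 6 * (\<Sum>\<iota>\<in>I. T \<iota> u u u * T \<iota> e e u)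
      = w ^ 2 * Q 4 / 2 + 60 * w ^ 6 * Q 1 ^ 4 - 3 * w ^ 3 * Q 4"
    using even_coeffs_eq(1)[OF *] by (simp add: power2_eq_square)
  show "9 * (\<Sum>\<iota>\<in>I. T \<iota> e e u ^ 2) + 6 * (\<Sum>\<iota>\<in>I. T \<iota> u u e * T \<iota> e e e)
      = w ^ 2 * Q 2 / 2 + 60 * w ^ 6 * Q 1 ^ 2 - 3 * w ^ 3 * Q 1 ^ 2"
    using even_coeffs_eq(2)[OF *] by (simp add: power2_eq_square)
  show "(\<Sum>\<iota>\<in>I. T \<iota> e e e ^ 2) = w / 2 + w ^ 2 / 2 + 4 * w ^ 6 - 3 * w ^ 3"
    using even_coeffs_eq(3)[OF *] by (simp add: power2_eq_square)
qed

section \<open>Entries of the invariant Gram matrix\<close>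

lemma permutation_to_23:
  assumes "j \<in> {2..n}" "l \<in> {2..n}" "j \<noteq> l"
  obtains p where "p permutes {1..n}" "p 1 = 1" "p 2 = j" "p 3 = l"
proof -
  \<comment> \<open>The preimage of \<open>l\<close> under the outer swap, which moves
    \<open>l\<close> when \<open>l = 2\<close>.\<close>
  define l' where "l' = transpose 2 j l"
  have l': "l' \<in> {2..n}" "l' \<noteq> 2"
    using assms by (auto simp: l'_def transpose_def)
  let ?p = "transpose 2 j \<circ> transpose 3 l'"
  have "?p permutes {1..n}"
    using assms l' n_ge by (intro permutes_compose permutes_swap_id) auto
  moreover have "?p 1 = 1" "?p 2 = j" "?p 3 = l"
    using assms l' by (auto simp: transpose_def l'_def)
  ultimately show ?thesis by (rule that)
qed

lemma transpose_permutes: "a \<in> {1..3} \<Longrightarrow> b \<in> {1..3} \<Longrightarrow> transpose a b permutes {1..n}"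
  using n_ge by (intro permutes_swap_id) auto

text \<open>Let v_m be the vector over \<iota> of the coefficients of the monomial m in
  \<open>T \<iota> x x x\<close>. Since v_112 is three times \<open>T \<iota> e e (ev 2)\<close>,
  and similarly for v_122, these are \<gamma> = |v_112|^2 / 9, \<beta> = <v_111, v_122> / 3,
  \<delta> = <v_112, v_113> / 9 and \<epsilon> = <v_122, v_133> / 9.\<close>

definition "\<gamma> = (\<Sum>\<iota>\<in>I. T \<iota> e e (ev 2) ^ 2)"
definition "\<beta> = (\<Sum>\<iota>\<in>I. T \<iota> e e e * T \<iota> (ev 2) (ev 2) e)"
definition "\<delta> = (\<Sum>\<iota>\<in>I. T \<iota> e e (ev 2) * T \<iota> e e (ev 3))"
definition "\<epsilon> = (\<Sum>\<iota>\<in>I. T \<iota> (ev 2) (ev 2) e * T \<iota> (ev 3) (ev 3) e)"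

lemma gram_11j:
  assumes "j \<in> {2..n}"
  shows "(\<Sum>\<iota>\<in>I. T \<iota> e e (ev j) ^ 2) = \<gamma>"
  unfolding \<gamma>_def power2_eq_square
  using permute_ev[OF permutes_swap_id[of 2 "{1..n}" j], of 1 1 2 1 1 2] assms n_ge
  by (simp add: transpose_def)

text \<open>Swapping 1 and j reduces this to \<open>gram_11j\<close>. Hence a bound on \<gamma> also
  controls the squared norms needed in \<open>sum_1jj_bound\<close>.\<close>

lemma gram_1jj:
  assumes "j \<in> {2..n}"
  shows "(\<Sum>\<iota>\<in>I. T \<iota> (ev j) (ev j) e ^ 2) = \<gamma>"
  unfolding gram_11j[OF assms, symmetric] power2_eq_square
  using permute_ev[OF permutes_swap_id[of 1 "{1..n}" j], of 1 1 j 1 1 j] assms n_ge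
  by (simp add: transpose_def)

lemma gram_111_1jj:
  assumes "j \<in> {2..n}"
  shows "(\<Sum>\<iota>\<in>I. T \<iota> e e e * T \<iota> (ev j) (ev j) e) = \<beta>"
  unfolding \<beta>_def
  using permute_ev[OF permutes_swap_id[of 2 "{1..n}" j], of 1 1 1 2 2 1] assms n_ge
  by (simp add: transpose_def)

lemma gram_11j_11l:
  assumes "j \<in> {2..n}" "l \<in> {2..n}" "j \<noteq> l"
  shows "(\<Sum>\<iota>\<in>I. T \<iota> e e (ev j) * T \<iota> e e (ev l)) = \<delta>"
proof -
  obtain p where "p permutes {1..n}" "p 1 = 1" "p 2 = j" "p 3 = l"
    using permutation_to_23[OF assms] .
  then show ?thesis
    unfolding \<delta>_def using permute_ev[of p 1 1 2 1 1 3] by simp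
qed

lemma gram_1jj_1ll:
  assumes "j \<in> {2..n}" "l \<in> {2..n}" "j \<noteq> l"
  shows "(\<Sum>\<iota>\<in>I. T \<iota> (ev j) (ev j) e * T \<iota> (ev l) (ev l) e) = \<epsilon>"
proof -
  obtain p where "p permutes {1..n}" "p 1 = 1" "p 2 = j" "p 3 = l"
    using permutation_to_23[OF assms] .
  then show ?thesis
    unfolding \<epsilon>_def using permute_ev[of p 2 2 1 3 3 1] by simp
qed

lemma psum_ev: "r > 0 \<Longrightarrow> psum n r (ev 2) = 1"
  unfolding psum_def using n_ge
  by (subst sum.mono_neutral_right[of _ "{2}"]) (auto simp: ev_def)

lemma psum_ev_add_ev: "r > 0 \<Longrightarrow> psum n r (\<lambda>i. s * ev 2 i + ev 3 i) = s ^ r + 1"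
  unfolding psum_def using n_ge
  by (subst sum.mono_neutral_right[of _ "{2,3}"]) (auto simp: ev_def)

text \<open>The squares contribute |v_112|^2 + 2 <v_111, v_122>; the terms on the right come from
  p_4 p_2, p_1^6 and p_4 p_1^2, in this order.\<close>

lemma coeff_x1_4_x2_2:
  "9 * \<gamma> + 6 * \<beta> = 1 / (2 * real n ^ 2) + 60 / real n ^ 6 - 3 / real n ^ 3"
  using slice_coeffs(2)[of "ev 2"]
  by (simp add: psum_ev \<gamma>_def \<beta>_def mult.commute power_divide) (simp add: ev_def)

text \<open>Compares coefficients of x_1^2 x_2^2 x_3^2. In the form this monomial comes from 4 p_1^6
  alone, with coefficient 4 * 90 / n^6. The squares give three inner products equal to \<epsilon>,
  each with factor 18, and the nonnegative |v_123|^2.\<close>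

lemma epsilon_le: "54 * \<epsilon> \<le> 360 / real n ^ 6"
proof -
  define w where "w = 1 / real n"
  let ?g = "\<lambda>f h. \<Sum>\<iota>\<in>I. f \<iota> * h \<iota>"
  let ?A = "\<lambda>\<iota>. T \<iota> (ev 2) (ev 2) e" and ?B = "\<lambda>\<iota>. T \<iota> (ev 2) (ev 3) e"
    and ?C = "\<lambda>\<iota>. T \<iota> (ev 3) (ev 3) e"
  let ?E0 = "\<lambda>\<iota>. T \<iota> (ev 3) (ev 3) (ev 3)" and ?E1 = "\<lambda>\<iota>. T \<iota> (ev 3) (ev 3) (ev 2)"
    and ?E2 = "\<lambda>\<iota>. T \<iota> (ev 2) (ev 2) (ev 3)" and ?E3 = "\<lambda>\<iota>. T \<iota> (ev 2) (ev 2) (ev 2)"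
  let ?F2 = "\<lambda>\<iota>. T \<iota> e e (ev 2)" and ?F3 = "\<lambda>\<iota>. T \<iota> e e (ev 3)"
  \<comment> \<open>This is \<open>slice_coeffs(1)\<close> at u = s e_2 + e_3, padded by zero terms
    to degree 6; the coefficient of s^2 is the one wanted.\<close>
  have *: "(9 * ?g ?C ?C + 6 * ?g ?E0 ?F3) + (36 * ?g ?B ?C + 6 * ?g ?E0 ?F2 + 18 * ?g ?E1 ?F3) * s
      + (18 * ?g ?A ?C + 36 * ?g ?B ?B + 18 * ?g ?E2 ?F3 + 18 * ?g ?E1 ?F2) * s ^ 2
      + (36 * ?g ?A ?B + 6 * ?g ?E3 ?F3 + 18 * ?g ?E2 ?F2) * s ^ 3
      + (9 * ?g ?A ?A + 6 * ?g ?E3 ?F2) * s ^ 4 + 0 * s ^ 5 + 0 * s ^ 6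
      = (w ^ 2 / 2 + 60 * w ^ 6 - 3 * w ^ 3) + 240 * w ^ 6 * s + 360 * w ^ 6 * s ^ 2
      + 240 * w ^ 6 * s ^ 3 + (w ^ 2 / 2 + 60 * w ^ 6 - 3 * w ^ 3) * s ^ 4 + 0 * s ^ 5 + 0 * s ^ 6"
    (is "?L s = ?R s") for s
  proof -
    let ?u = "\<lambda>i. s * ev 2 i + ev 3 i"
    have u1: "?u 1 = 0" by (simp add: ev_def)
    have cube: "T \<iota> ?u ?u ?u = ?E0 \<iota> + 3 * s * ?E1 \<iota> + 3 * s ^ 2 * ?E2 \<iota> + s ^ 3 * ?E3 \<iota>" for \<iota>
      using trilinear_cube_expand[OF trilinear, of \<iota> "ev 3" s "ev 2"] by (simp add: add.commute)
    have square: "T \<iota> ?u ?u e = s ^ 2 * ?A \<iota> + 2 * s * ?B \<iota> + ?C \<iota>" for \<iota>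
      by (rule trilinear_square_expand[OF trilinear])
    have lin: "T \<iota> e e ?u = s * ?F2 \<iota> + ?F3 \<iota>" for \<iota>
      by (simp add: D(5,8))
    have "?L s = 9 * (\<Sum>\<iota>\<in>I. T \<iota> ?u ?u e ^ 2) + 6 * (\<Sum>\<iota>\<in>I. T \<iota> ?u ?u ?u * T \<iota> e e ?u)"
      unfolding cube square lin mult_zero_left add_0_right
      unfolding sum_distrib_left sum_distrib_right sum.distrib[symmetric]
      by (intro sum.cong refl) (simp add: algebra_simps power_numeral_reduce)
    also have "\<dots> = w ^ 2 * (s ^ 4 + 1) / 2 + 60 * w ^ 6 * (s + 1) ^ 4 - 3 * w ^ 3 * (s ^ 4 + 1)"
      using slice_coeffs(1)[of ?u, OF u1] by (simp add: psum_ev_add_ev w_def)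
    also have "\<dots> = ?R s"
      by (simp add: field_simps power_numeral_reduce)
    finally show ?thesis .
  qed
  have "?g ?E2 ?F3 = \<epsilon>"
    unfolding \<epsilon>_def using permute_ev[OF transpose_permutes[of 1 3], of 2 2 3 1 1 3]
    by (simp add: transpose_def)
  moreover have "?g ?E1 ?F2 = \<epsilon>"
    unfolding \<epsilon>_def using permute_ev[OF transpose_permutes[of 1 2], of 3 3 2 1 1 2]
    by (simp add: transpose_def mult.commute)
  moreover have "?g ?A ?C = \<epsilon>" by (simp add: \<epsilon>_def)
  moreover have "?g ?B ?B \<ge> 0" by (intro sum_nonneg) simp
  ultimately show ?thesis
    using even_coeffs_eq(1)[OF *] by (simp add: w_def power_divide)
qed

section \<open>Inequalities between the Gram entries\<close>

lemma trilinear_expand_ev: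
  assumes "\<And>i. i \<notin> {2..n} \<Longrightarrow> u i = 0"
  shows "T \<iota> e e u = (\<Sum>j=2..n. u j * T \<iota> e e (ev j))"
proof -
  have "u = (\<lambda>i. \<Sum>j=2..n. u j * ev j i)"
    using assms by (auto simp: fun_eq_iff ev_def if_distrib cong: if_cong)
  then have "T \<iota> e e u = T \<iota> e e (\<lambda>i. \<Sum>j=2..n. u j * ev j i)" by simp
  then show ?thesis by (simp only: symmetric_trilinear_sum[OF trilinear finite_atLeastAtMost])
qed

lemma gram_11u:
  assumes "\<And>i. i \<notin> {2..n} \<Longrightarrow> u i = 0"
  shows "(\<Sum>\<iota>\<in>I. T \<iota> e e u ^ 2) = (\<gamma> - \<delta>) * psum n 2 u + \<delta> * psum n 1 u ^ 2"
proof -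
  have "T \<iota> e e u = (\<Sum>j=2..n. u j * T \<iota> e e (ev j))" for \<iota>
    by (rule trilinear_expand_ev) (rule assms)
  then have "(\<Sum>\<iota>\<in>I. T \<iota> e e u ^ 2) = (\<Sum>\<iota>\<in>I. (\<Sum>j=2..n. u j * T \<iota> e e (ev j)) ^ 2)"
    by simp
  also have "\<dots> = (\<gamma> - \<delta>) * (\<Sum>j=2..n. u j ^ 2) + \<delta> * (\<Sum>j=2..n. u j) ^ 2"
    by (rule sum_square_sum_const_gram) (simp_all add: gram_11j gram_11j_11l)
  finally show ?thesis by (simp add: psum_def)
qed

text \<open>The Gram matrix of the \<open>T \<iota> e e (ev j)\<close> is positive semidefinite,
  here tested on the all-ones vector. This bounds \<delta> below by about -\<gamma> / n.\<close>

lemma gamma_delta_nonneg: "\<gamma> + (real n - 2) * \<delta> \<ge> 0"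
proof -
  have "0 \<le> (\<Sum>\<iota>\<in>I. (\<Sum>j=2..n. 1 * T \<iota> e e (ev j)) ^ 2)"
    by (intro sum_nonneg) simp
  also have "\<dots> = (\<gamma> - \<delta>) * (\<Sum>j=2..n. 1 ^ 2) + \<delta> * (\<Sum>j=2..n. 1) ^ 2"
    by (intro sum_square_sum_const_gram) (simp_all add: gram_11j gram_11j_11l)
  also have "\<dots> = (real n - 1) * (\<gamma> + (real n - 2) * \<delta>)"
    using n_ge by (simp add: of_nat_diff power2_eq_square algebra_simps)
  finally show ?thesis
    using n_ge by (simp add: zero_le_mult_iff)
qed

text \<open>
  The factor \<open>1/6\<close> approximately minimizes the distance from \<open>\<Sum>\<^sub>j T e\<^sub>j e\<^sub>j e\<close> to the line spanned by
  \<open>T e e e\<close>, since \<open>\<alpha> \<approx> 1 / (2n)\<close> and \<open>\<beta> \<approx> 1 / (12n\<^sup>2)\<close>.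
\<close>

lemma sum_1jj_bound:
  defines "\<alpha> \<equiv> \<Sum>\<iota>\<in>I. T \<iota> e e e ^ 2" and "N \<equiv> real n - 1"
  shows "0 \<le> \<alpha> / 36 - N * \<beta> / 3 + (\<gamma> - \<epsilon>) * N + \<epsilon> * N ^ 2"
proof -
  let ?w = "\<lambda>\<iota>. \<Sum>j=2..n. T \<iota> (ev j) (ev j) e"
  have N: "real (card {2..n}) = N" using n_ge by (simp add: N_def of_nat_diff)
  have "(\<Sum>\<iota>\<in>I. (\<Sum>j=2..n. 1 * T \<iota> (ev j) (ev j) e) ^ 2)
      = (\<gamma> - \<epsilon>) * (\<Sum>j=2..n. 1 ^ 2) + \<epsilon> * (\<Sum>j=2..n. 1) ^ 2"
    by (rule sum_square_sum_const_gram) (simp_all add: gram_1jj gram_1jj_1ll)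
  then have ww: "(\<Sum>\<iota>\<in>I. ?w \<iota> ^ 2) = (\<gamma> - \<epsilon>) * N + \<epsilon> * N ^ 2"
    using N by simp
  have "(\<Sum>\<iota>\<in>I. T \<iota> e e e * ?w \<iota>) = (\<Sum>j=2..n. \<Sum>\<iota>\<in>I. T \<iota> e e e * T \<iota> (ev j) (ev j) e)"
    by (subst sum.swap) (simp add: sum_distrib_left)
  also have "\<dots> = N * \<beta>"
    using N by (simp add: gram_111_1jj)
  finally have tw: "(\<Sum>\<iota>\<in>I. T \<iota> e e e * ?w \<iota>) = N * \<beta>" .
  have "0 \<le> (\<Sum>\<iota>\<in>I. (T \<iota> e e e / 6 - ?w \<iota>) ^ 2)"
    by (intro sum_nonneg) simp
  also have "\<dots> = (\<Sum>\<iota>\<in>I. 1/36 * T \<iota> e e e ^ 2 - 1/3 * (T \<iota> e e e * ?w \<iota>) + ?w \<iota> ^ 2)"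
    by (intro sum.cong refl) (simp add: power2_eq_square field_simps)
  also have "\<dots> = 1/36 * \<alpha> - 1/3 * (N * \<beta>) + ((\<gamma> - \<epsilon>) * N + \<epsilon> * N ^ 2)"
    by (simp only: sum.distrib sum_subtractf sum_distrib_left[symmetric] ww tw \<alpha>_def)
  finally show ?thesis by simp
qed

text \<open>
  Flipping the sign of the first coordinate of \<open>u + e\<close> changes the value of the cubic form by
  \<open>6 T u u e + 2 T e e e\<close>. If \<open>mean_form n\<close> is small at \<open>u + e\<close> and \<open>u - e\<close>, this determines
  \<open>T u u e\<close> up to a small error.
\<close>

lemma near_zero_bound:
  assumes "u 1 = 0" and "\<theta> > 0"
  defines "\<alpha> \<equiv> \<Sum>\<iota>\<in>I. T \<iota> e e e ^ 2"
  shows "9 * (\<Sum>\<iota>\<in>I. T \<iota> e e u ^ 2) \<le>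
    psum n 2 u / (2 * real n ^ 2) + 60 * psum n 1 u ^ 2 / real n ^ 6 - 3 * psum n 1 u ^ 2 / real n ^ 3
    + 2 * \<alpha> + \<theta> * \<alpha>
    + (mean_form n (\<lambda>i. u i + 1 * e i) + mean_form n (\<lambda>i. u i + (- 1) * e i)) / (2 * \<theta>)"
proof -
  define p q where "p = (\<lambda>\<iota>. T \<iota> u u u + 3 * T \<iota> u u e + 3 * T \<iota> e e u + T \<iota> e e e)"
    and "q = (\<lambda>\<iota>. T \<iota> u u u - 3 * T \<iota> u u e + 3 * T \<iota> e e u - T \<iota> e e e)"
  have P: "mean_form n (\<lambda>i. u i + 1 * e i) = (\<Sum>\<iota>\<in>I. p \<iota> ^ 2)"
    and Q: "mean_form n (\<lambda>i. u i + (- 1) * e i) = (\<Sum>\<iota>\<in>I. q \<iota> ^ 2)"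
    by (simp_all only: square_sum[symmetric] trilinear_cube_expand[OF trilinear])
      (simp_all add: p_def q_def)
  have 1: "6 * (T \<iota> u u e * T \<iota> e e e) = p \<iota> * T \<iota> e e e - q \<iota> * T \<iota> e e e - 2 * T \<iota> e e e ^ 2" for \<iota>
    by (simp add: p_def q_def power2_eq_square algebra_simps)
  \<comment> \<open>Young's inequality for both products; \<theta> weighs the error from
    \<open>T \<iota> e e e\<close> against the values of the form.\<close>
  have 2: "- (p \<iota> * T \<iota> e e e - q \<iota> * T \<iota> e e e)
      \<le> \<theta> * T \<iota> e e e ^ 2 + (p \<iota> ^ 2 + q \<iota> ^ 2) / (2 * \<theta>)" for \<iota>
  proof -
    have "0 \<le> ((p \<iota> + \<theta> * T \<iota> e e e) ^ 2 + (q \<iota> - \<theta> * T \<iota> e e e) ^ 2) / (2 * \<theta>)"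
      using \<open>\<theta> > 0\<close> by simp
    also have "\<dots> = \<theta> * T \<iota> e e e ^ 2 + (p \<iota> ^ 2 + q \<iota> ^ 2) / (2 * \<theta>)
        + (p \<iota> * T \<iota> e e e - q \<iota> * T \<iota> e e e)"
      using \<open>\<theta> > 0\<close> by (simp add: power2_eq_square field_simps)
    finally show ?thesis by simp
  qed
  have "- 6 * (T \<iota> u u e * T \<iota> e e e)
      \<le> 2 * T \<iota> e e e ^ 2 + \<theta> * T \<iota> e e e ^ 2 + (p \<iota> ^ 2 + q \<iota> ^ 2) / (2 * \<theta>)" for \<iota>
    using 1[of \<iota>] 2[of \<iota>] by linarith
  then have "(\<Sum>\<iota>\<in>I. - 6 * (T \<iota> u u e * T \<iota> e e e))
      \<le> (\<Sum>\<iota>\<in>I. 2 * T \<iota> e e e ^ 2 + \<theta> * T \<iota> e e e ^ 2 + (p \<iota> ^ 2 + q \<iota> ^ 2) / (2 * \<theta>))"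
    by (rule sum_mono)
  then have "- 6 * (\<Sum>\<iota>\<in>I. T \<iota> u u e * T \<iota> e e e)
      \<le> 2 * \<alpha> + \<theta> * \<alpha> + ((\<Sum>\<iota>\<in>I. p \<iota> ^ 2) + (\<Sum>\<iota>\<in>I. q \<iota> ^ 2)) / (2 * \<theta>)"
    by (simp only: sum.distrib sum_distrib_left[symmetric] sum_divide_distrib[symmetric] \<alpha>_def)
  \<comment> \<open>By \<open>slice_coeffs(2)\<close>, the left side differs by explicit terms from
    -6 <T u u e, T e e e>, which has just been bounded.\<close>
  then show ?thesis
    using slice_coeffs(2)[of u, OF assms(1)] unfolding P Q
    by (simp add: power_divide)
qed

text \<open>The bound of \<open>near_zero_bound\<close> at a suitable u makes \<gamma> small against
  n^-2. Then \<open>coeff_x1_4_x2_2\<close> forces \<beta> to be about 1 / (12 n^2), which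
  contradicts \<open>sum_1jj_bound\<close> because \<epsilon> is negligible.\<close>

lemma n_ne_million: "n \<noteq> 1000000"
proof
  assume n: "n = 1000000"
  \<comment> \<open>The coordinate sum is \<open>707107 \<approx> n / sqrt 2\<close>.\<close>
  define u :: "nat \<Rightarrow> real" where
    "u = (\<lambda>i. if i \<in> {2..146447} then -1 else if i \<in> {146448..1000000} then 1 else 0)"
  have split: "{2..n} = {2..146447} \<union> {146448..1000000}"
    using n by auto
  have psum: "psum n r u = (-1) ^ r * 146446 + 853553" if "r > 0" for r
  proof -
    have "psum n r u = (\<Sum>i\<in>{2..146447}. u i ^ r) + (\<Sum>i\<in>{146448..1000000}. u i ^ r)"
      unfolding psum_def split by (rule sum.union_disjoint) auto
    also have "(\<Sum>i\<in>{2..146447}. u i ^ r) = (\<Sum>i\<in>{2..146447::nat}. (-1) ^ r)"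
      by (intro sum.cong) (auto simp: u_def)
    also have "(\<Sum>i\<in>{146448..1000000}. u i ^ r) = (\<Sum>i\<in>{146448..1000000::nat}. 1)"
      by (intro sum.cong) (auto simp: u_def)
    finally show ?thesis by simp
  qed
  have u1: "u 1 = 0" and u0: "\<And>i. i \<notin> {2..n} \<Longrightarrow> u i = 0"
    by (auto simp: u_def n)
  have rn: "real n = 1000000" using n by simp
  have psum1: "psum n 1 u = 707107" using psum[of 1] by simp
  have psums: "psum n 2 u = 999999" "psum n 4 u = 999999" "psum n 6 u = 999999"
    by (simp_all add: psum)
  define \<alpha> where "\<alpha> = (\<Sum>\<iota>\<in>I. T \<iota> e e e ^ 2)"
  have \<alpha>: "\<alpha> = 1 / 2000000 + 1 / 2000000000000 + 4 / 1000000 ^ 6 - 3 / 1000000 ^ 3"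
    unfolding \<alpha>_def slice_coeffs(3)[of u, OF u1] rn by (simp add: power_divide)
  \<comment> \<open>Both points are sign vectors, with sums 707108 and 707106. There 2s - 1 is at
    most about 3.5 / 10^6 in absolute value, and the form (s + 1)(2s - 1)^2 is quadratic in
    it.\<close>
  have plus: "mean_form n (\<lambda>i. u i + 1 * e i) \<le> 2 / 10 ^ 11"
    and minus: "mean_form n (\<lambda>i. u i + (- 1) * e i) \<le> 2 / 10 ^ 11"
    using n_ge by (simp_all only: mean_form_add_ev[of u n, OF u1] psum1 psums rn) (simp_all add: power_divide)
  \<comment> \<open>The terms of order 1/n cancel, as 1/2 - 3/2 + 1 = 0. The choice \<theta> = 1/160
    balances the last two summands, each at most about 3.2 / 10^9.\<close>
  have "9 * (\<Sum>\<iota>\<in>I. T \<iota> e e u ^ 2) \<le>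
    psum n 2 u / (2 * real n ^ 2) + 60 * psum n 1 u ^ 2 / real n ^ 6 - 3 * psum n 1 u ^ 2 / real n ^ 3
    + 2 * \<alpha> + 1/160 * \<alpha>
    + (mean_form n (\<lambda>i. u i + 1 * e i) + mean_form n (\<lambda>i. u i + (- 1) * e i)) / (2 * (1/160))"
    unfolding \<alpha>_def by (rule near_zero_bound) (simp_all add: u1)
  also have "\<dots> \<le> 1 / 10 ^ 8"
    using plus minus unfolding psum1 psums rn \<alpha> by simp
  finally have "9 * ((\<gamma> - \<delta>) * 999999 + \<delta> * 707107 ^ 2) \<le> 1 / 10 ^ 8"
    using gram_11u[of u] u0 by (simp add: psum1 psums)
  moreover have "\<gamma> + 999998 * \<delta> \<ge> 0"
    using gamma_delta_nonneg by (simp add: rn)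
  \<comment> \<open>As 707107^2 is about n^2 / 2, inserting the lower bound on \<delta> still leaves
    about \<gamma> n / 2 inside the bracket.\<close>
  ultimately have \<gamma>: "\<gamma> \<le> 3 / 10 ^ 15" by simp
  have "9 * \<gamma> + 6 * \<beta> = 1 / (2 * 1000000 ^ 2) + 60 / 1000000 ^ 6 - 3 / 1000000 ^ 3"
    using coeff_x1_4_x2_2 by (simp add: rn)
  moreover have "54 * \<epsilon> \<le> 360 / 1000000 ^ 6"
    using epsilon_le by (simp add: rn)
  moreover have "0 \<le> \<alpha> / 36 - 999999 * \<beta> / 3 + (\<gamma> - \<epsilon>) * 999999 + \<epsilon> * 999999 ^ 2"
    using sum_1jj_bound by (simp add: rn \<alpha>_def)
  \<comment> \<open>Numerically, \<alpha> / 36 is about 1.4 / 10^8 and the \<gamma> term is at most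
    0.3 / 10^8, while the subtracted \<beta> term exceeds 2.6 / 10^8.\<close>
  ultimately show False
    using \<gamma> unfolding \<alpha> by simp
qed

end

section \<open>Averaging a sum of squares over permutations\<close>

lemma mean_form_permute:
  assumes "p permutes {1..n}"
  shows "mean_form n (x \<circ> p) = mean_form n x"
proof -
  have "pmean n r (x \<circ> p) = pmean n r x" for r
    unfolding pmean_def using sum.permute[OF assms, of "\<lambda>i. x i ^ r"] by (simp add: o_def)
  then show ?thesis by (simp add: mean_form_def)
qed

lemma mean_form_scale: "mean_form n (\<lambda>i. t * x i) = mean_form n x * t ^ 6"
proof -
  have "pmean n r (\<lambda>i. t * x i) = t ^ r * pmean n r x" for r
    by (simp add: pmean_def power_mult_distrib sum_distrib_left)
  then show ?thesis
    by (simp add: mean_form_def power_mult_distrib algebra_simps power_numeral_reduce)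
qed

lemma symmetric_trilinear_permute:
  assumes "symmetric_trilinear T"
  shows "symmetric_trilinear (\<lambda>x y z. c * T (x \<circ> p) (y \<circ> p) (z \<circ> p))"
  unfolding symmetric_trilinear_def o_def
  using symmetric_trilinearD[OF assms]
  by (auto simp: algebra_simps intro: symmetric_trilinearD[OF assms])

text \<open>Each square is at most the whole form, which is homogeneous of degree 6, so
  \<open>cubic_growth_imp_trilinear\<close> applies to each q_k. The new family consists of all q_k
  with permuted variables, indexed by pairs of k and a permutation.\<close>

lemma sum_of_squares_imp_symmetric_cubic_family:
  assumes sos: "sum_of_squares n (finite_form 6 n (four_term_form (1/2) (1/2) 4))"
    and n: "n \<ge> 3"
  shows "\<exists>(I :: (nat \<times> (nat \<Rightarrow> nat)) set) T. symmetric_cubic_family I T n"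
proof -
  obtain qs where qs: "finite_form 6 n (four_term_form (1/2) (1/2) 4) = (\<Sum>q\<leftarrow>qs. q ^ 2)"
    using sos by (auto simp: sum_of_squares_def)
  let ?m = "length qs"
  have f: "mean_form n x = (\<Sum>k<?m. poly_eval x (qs ! k) ^ 2)" for x
  proof -
    have "mean_form n x = poly_eval x (\<Sum>q\<leftarrow>qs. q ^ 2)"
      by (simp add: mean_form_def poly_eval_four_term_form flip: qs)
    also have "\<dots> = (\<Sum>k<?m. poly_eval x (qs ! k) ^ 2)"
      by (simp add: sum_list_sum_nth poly_eval_sum poly_eval_power atLeast0LessThan)
    finally show ?thesis .
  qed
  \<comment> \<open>For k beyond the list the zero form is the default, since the locale asks for
    trilinearity at every index.\<close>
  have "\<exists>T. symmetric_trilinear T \<and> (k < ?m \<longrightarrow> (\<forall>x. poly_eval x (qs ! k) = T x x x))" for k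
  proof (cases "k < ?m")
    case True
    have "poly_eval (\<lambda>i. t * x i) (qs ! k) ^ 2 \<le> mean_form n x * t ^ 6" for x t
    proof -
      have "poly_eval (\<lambda>i. t * x i) (qs ! k) ^ 2 \<le> mean_form n (\<lambda>i. t * x i)"
        unfolding f by (rule member_le_sum[of k]) (use True in auto)
      then show ?thesis by (simp add: mean_form_scale)
    qed
    then show ?thesis
      using cubic_growth_imp_trilinear[of "qs ! k" "mean_form n"] by blast
  next
    case False
    then show ?thesis
      by (intro exI[of _ "\<lambda>x y z. 0"]) (simp add: symmetric_trilinear_def)
  qed
  then obtain T where T: "\<And>k. symmetric_trilinear (T k)"
    "\<And>k x. k < ?m \<Longrightarrow> poly_eval x (qs ! k) = T k x x x"
    by metis
  let ?P = "{p. p permutes {1..n}}"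
  \<comment> \<open>Scaling by \<open>c\<close> turns the sum of squares over all n! permutations
    into their average.\<close>
  define c where "c = 1 / sqrt (fact n)"
  have c: "c ^ 2 * fact n = 1"
    by (simp add: c_def power_divide)
  define T' where "T' = (\<lambda>(k, p :: nat \<Rightarrow> nat) x y z. c * T k (x \<circ> p) (y \<circ> p) (z \<circ> p))"
  have "symmetric_cubic_family ({..<?m} \<times> ?P) T' n"
  proof
    show "symmetric_trilinear (T' \<iota>)" for \<iota>
      using symmetric_trilinear_permute[OF T(1)] by (cases \<iota>) (simp add: T'_def)
    show "3 \<le> n" by (rule n)
    fix x
    have "(\<Sum>\<iota>\<in>{..<?m} \<times> ?P. T' \<iota> x x x ^ 2) = (\<Sum>k<?m. \<Sum>p\<in>?P. c ^ 2 * T k (x \<circ> p) (x \<circ> p) (x \<circ> p) ^ 2)"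
      by (simp add: T'_def power_mult_distrib sum.cartesian_product case_prod_unfold)
    also have "\<dots> = (\<Sum>p\<in>?P. c ^ 2 * mean_form n (x \<circ> p))"
      by (subst sum.swap) (simp add: f T(2) sum_distrib_left)
    also have "\<dots> = (\<Sum>p\<in>?P. c ^ 2 * mean_form n x)"
      by (intro sum.cong) (simp_all add: mean_form_permute)
    also have "\<dots> = mean_form n x"
      using c by (simp add: card_permutations[of _ n] mult.commute[of "fact n"])
    finally show "(\<Sum>\<iota>\<in>{..<?m} \<times> ?P. T' \<iota> x x x ^ 2) = mean_form n x" .
  next
    fix \<sigma> :: "nat \<Rightarrow> nat" and x y z x' y' z' :: "nat \<Rightarrow> real"
    assume \<sigma>: "\<sigma> permutes {1..n}"
    let ?h = "\<lambda>k (p :: nat \<Rightarrow> nat). c * T k (x \<circ> p) (y \<circ> p) (z \<circ> p) * (c * T k (x' \<circ> p) (y' \<circ> p) (z' \<circ> p))"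
    have "(\<Sum>\<iota>\<in>{..<?m} \<times> ?P. T' \<iota> (x \<circ> \<sigma>) (y \<circ> \<sigma>) (z \<circ> \<sigma>) * T' \<iota> (x' \<circ> \<sigma>) (y' \<circ> \<sigma>) (z' \<circ> \<sigma>))
        = (\<Sum>k<?m. \<Sum>p\<in>?P. ?h k (\<sigma> \<circ> p))"
      by (simp add: T'_def comp_assoc sum.cartesian_product case_prod_unfold)
    \<comment> \<open>Left composition with \<sigma> merely reindexes the group of
      permutations.\<close>
    also have "\<dots> = (\<Sum>k<?m. \<Sum>p\<in>?P. ?h k p)"
      by (rule sum.cong[OF refl], rule setum_permutations_compose_left[OF \<sigma>, symmetric])
    also have "\<dots> = (\<Sum>\<iota>\<in>{..<?m} \<times> ?P. T' \<iota> x y z * T' \<iota> x' y' z')"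
      by (simp add: T'_def sum.cartesian_product case_prod_unfold)
    finally show "(\<Sum>\<iota>\<in>{..<?m} \<times> ?P. T' \<iota> (x \<circ> \<sigma>) (y \<circ> \<sigma>) (z \<circ> \<sigma>) * T' \<iota> (x' \<circ> \<sigma>) (y' \<circ> \<sigma>) (z' \<circ> \<sigma>))
        = (\<Sum>\<iota>\<in>{..<?m} \<times> ?P. T' \<iota> x y z * T' \<iota> x' y' z')" .
  qed
  then show ?thesis by blast
qed

theorem mainTheorem5:
  shows "(\<forall>a b c :: real. a \<ge> 0 \<and> b \<ge> 0 \<and> c \<ge> 0 \<and> a * b * c = 1 \<longrightarrow>
            limit_term a {#6#} + limit_term b {#4, 2#} + limit_term c {#1, 1, 1, 1, 1, 1#}
              - limit_term 3 {#4, 1, 1#} \<in> limit_nonneg 6) \<and>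
         limit_term (1/2) {#6#} + limit_term (1/2) {#4, 2#} + limit_term 4 {#1, 1, 1, 1, 1, 1#}
           - limit_term 3 {#4, 1, 1#} \<notin> limit_sos 6"
  unfolding four_term_form_def[symmetric]
proof (intro conjI allI impI)
  show "four_term_form a b c \<in> limit_nonneg 6" if "a \<ge> 0 \<and> b \<ge> 0 \<and> c \<ge> 0 \<and> a * b * c = 1" for a b c
    using that by (intro four_term_form_nonneg) auto
  show "four_term_form (1/2) (1/2) 4 \<notin> limit_sos 6"
  proof
    assume "four_term_form (1/2) (1/2) 4 \<in> limit_sos 6"
    then have "sum_of_squares 1000000 (finite_form 6 1000000 (four_term_form (1/2) (1/2) 4))"
      by (simp add: limit_sos_def)
    then obtain I :: "(nat \<times> (nat \<Rightarrow> nat)) set" and T where "symmetric_cubic_family I T 1000000"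
      using sum_of_squares_imp_symmetric_cubic_family by fastforce
    then show False
      using symmetric_cubic_family.n_ne_million by blast
  qed
qed

end
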